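(* Let $m<M$ be real numbers, let $f:[m,M]\to(0,\infty)$ be a continuous log-convex function, let $B_1,\dots,B_n\in\mathbb{B}(\mathscr{H})_h$ be operators with spectra contained in $[m,M]$, and let $\Phi_1,\dots,\Phi_n$ be positive linear maps on $\mathbb{B}(\mathscr{H})$ with $\sum_{i=1}^n\Phi_i(I)=I$. Put $K=K_f(m,M)=\dfrac{f\left(\frac{m+M}{2}\right)^2}{f(m)f(M)}$, $\widetilde{t}=\frac12-\frac{1}{M-m}\left|t-\frac{m+M}{2}\right|$, and $S=\sum_{i=1}^n\Phi_i(B_i)$. Then \begin{align*} \sum_{i=1}^n\Phi_i(f(B_i))+f(M+m-S)&\le \sum_{i=1}^n\Phi_i\left(K^{\widetilde{B_i}}f(m)^{\frac{M-B_i}{M-m}}f(M)^{\frac{B_i-m}{M-m}}\right)\\ &\quad+K^{\widetilde{M+m-S}}f(m)^{\frac{S-m}{M-m}}f(M)^{\frac{M-S}{M-m}}\\ &\le f(m)+f(M). \end{align*}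
   Context: $\mathscr{H}$ is a complex Hilbert space, $\mathbb{B}(\mathscr{H})$ is the algebra of bounded linear operators on $\mathscr{H}$ with identity $I$, and $\mathbb{B}(\mathscr{H})_h$ is its real subspace of self-adjoint operators. For self-adjoint $X,Y$, $X\le Y$ means that $Y-X$ is positive, i.e. $\langle (Y-X)x,x\rangle\ge 0$ for all $x$; a real number $c$ in an operator expression stands for $cI$. A linear map $\Phi:\mathbb{B}(\mathscr{H})\to\mathbb{B}(\mathscr{H})$ is positive if $\Phi(X)\ge0$ whenever $X\ge0$. A function $f:[m,M]\to(0,\infty)$ is log-convex if $\log f$ is convex, i.e. $f(\alpha x+(1-\alpha)y)\le f(x)^{\alpha}f(y)^{1-\alpha}$ for all $x,y\in [m,M]$, $\alpha\in[0,1]$. For self-adjoint $X$ with spectrum in $[m,M]$, $f(X)$, $\widetilde{X}=\frac12-\frac1{M-m}\left|X-\frac{m+M}{2}\right|$, and the products of powers with operator exponents that depend on $X$ are all defined by the continuous functional calculus of $X$. *)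

theory Defs
  imports "HOL-Analysis.Analysis" "HOL-Computational_Algebra.Polynomial"
begin

class complex_vector = real_vector +
  fixes scaleC :: "complex \<Rightarrow> 'a \<Rightarrow> 'a" (infixr "*\<^sub>C" 75)
  assumes scaleC_add_right: "c *\<^sub>C (x + y) = c *\<^sub>C x + c *\<^sub>C y"
    and scaleC_add_left: "(c + d) *\<^sub>C x = c *\<^sub>C x + d *\<^sub>C x"
    and scaleC_scaleC: "c *\<^sub>C (d *\<^sub>C x) = (c * d) *\<^sub>C x"
    and scaleC_one: "1 *\<^sub>C x = x"
    and scaleR_scaleC: "r *\<^sub>R x = complex_of_real r *\<^sub>C x"

definition clinear_map :: "('a::complex_vector \<Rightarrow> 'b::complex_vector) \<Rightarrow> bool" where
  "clinear_map F \<longleftrightarrow> (\<forall>x y. F (x + y) = F x + F y) \<and> (\<forall>c x. F (c *\<^sub>C x) = c *\<^sub>C F x)"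

text \<open>A complex Hilbert space; completeness is part of \<^class>\<open>banach\<close>. The inner product is linear
  in its first argument; its definiteness follows from the norm axiom. The zero space is allowed.\<close>

class complex_hilbert = complex_vector + banach +
  fixes cinner :: "'a \<Rightarrow> 'a \<Rightarrow> complex"
  assumes cinner_commute: "cinner x y = cnj (cinner y x)"
    and cinner_add_left: "cinner (x + y) z = cinner x z + cinner y z"
    and cinner_scaleC_left: "cinner (c *\<^sub>C x) y = c * cinner x y"
    and cinner_self_nonneg: "cinner x x \<in> \<real>\<^sub>\<ge>\<^sub>0"
    and norm_eq_sqrt_cinner: "norm x = sqrt (Re (cinner x x))"

instantiation complex :: complex_hilbert
begin
definition "scaleC (c::complex) (x::complex) = c * x"
definition "cinner (x::complex) y = x * cnj y"
instance
  by standard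
    (auto simp: scaleC_complex_def cinner_complex_def algebra_simps scaleR_conv_of_real
      complex_mult_cnj cmod_def complex_nonneg_Reals_iff)
end

text \<open>The algebra of bounded (complex) linear operators. The norm is inherited from the real bounded
  linear maps, where it is the usual operator norm.\<close>

typedef (overloaded) ('a::complex_hilbert) bop =
  "{T :: 'a \<Rightarrow>\<^sub>L 'a. \<forall>c x. blinfun_apply T (c *\<^sub>C x) = c *\<^sub>C blinfun_apply T x}"
  morphisms bop_blinfun Abs_bop
proof
  show "0 \<in> {T :: 'a \<Rightarrow>\<^sub>L 'a. \<forall>c x. blinfun_apply T (c *\<^sub>C x) = c *\<^sub>C blinfun_apply T x}"
    using scaleC_add_right[of _ "0::'a" 0] by simp
qed

setup_lifting type_definition_bop

lift_definition bop_apply :: "'a::complex_hilbert bop \<Rightarrow> 'a \<Rightarrow> 'a" is blinfun_apply .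

lemma scaleC_zero_right: "c *\<^sub>C (0::'a::complex_vector) = 0"
  using scaleC_add_right[of c "0::'a" 0] by simp

lemma scaleC_minus_right: "c *\<^sub>C (- x) = - (c *\<^sub>C (x::'a::complex_vector))"
  using scaleC_add_right[of c x "-x"] by (simp add: scaleC_zero_right add_eq_0_iff)

lemma scaleC_diff_right: "c *\<^sub>C (x - y) = c *\<^sub>C x - c *\<^sub>C (y::'a::complex_vector)"
  using scaleC_add_right[of c x "-y"] by (simp add: scaleC_minus_right)

lemma norm_scaleC: "norm (c *\<^sub>C x) = cmod c * norm (x::'a::complex_hilbert)"
proof -
  have "cinner (c *\<^sub>C x) (c *\<^sub>C x) = c * cnj c * cinner x x"
    by (metis cinner_commute cinner_scaleC_left complex_cnj_mult mult.assoc)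
  then have "Re (cinner (c *\<^sub>C x) (c *\<^sub>C x)) = (cmod c)\<^sup>2 * Re (cinner x x)"
    by (simp add: complex_norm_square [symmetric])
  then show ?thesis
    by (simp add: norm_eq_sqrt_cinner[of x] norm_eq_sqrt_cinner[of "c *\<^sub>C x"] real_sqrt_mult)
qed

instantiation bop :: (complex_hilbert) real_vector
begin
lift_definition zero_bop :: "'a bop" is 0 by (simp add: scaleC_zero_right)
lift_definition plus_bop :: "'a bop \<Rightarrow> 'a bop \<Rightarrow> 'a bop" is "(+)"
  by (simp add: plus_blinfun.rep_eq scaleC_add_right)
lift_definition minus_bop :: "'a bop \<Rightarrow> 'a bop \<Rightarrow> 'a bop" is "(-)"
  by (simp add: minus_blinfun.rep_eq scaleC_diff_right)
lift_definition uminus_bop :: "'a bop \<Rightarrow> 'a bop" is uminus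
  by (simp add: uminus_blinfun.rep_eq scaleC_minus_right)
lift_definition scaleR_bop :: "real \<Rightarrow> 'a bop \<Rightarrow> 'a bop" is "(*\<^sub>R)"
  by (simp add: scaleR_blinfun.rep_eq scaleR_scaleC scaleC_scaleC mult.commute)
instance by standard (transfer, simp add: algebra_simps)+
end

instantiation bop :: (complex_hilbert) real_normed_vector
begin
lift_definition norm_bop :: "'a bop \<Rightarrow> real" is norm .
definition "dist (S::'a bop) T = norm (S - T)"
definition "sgn (T::'a bop) = T /\<^sub>R norm T"
definition
  "(uniformity :: ('a bop \<times> 'a bop) filter) = (INF e\<in>{0<..}. principal {(x, y). dist x y < e})"
definition
  "open (U :: 'a bop set) = (\<forall>x\<in>U. eventually (\<lambda>(x', y). x' = x \<longrightarrow> y \<in> U) uniformity)"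
instance
proof
  fix S T :: "'a bop" and r :: real and U :: "'a bop set"
  show "dist S T = norm (S - T)" "sgn T = T /\<^sub>R norm T"
    "(uniformity :: ('a bop \<times> 'a bop) filter) = (INF e\<in>{0<..}. principal {(x, y). dist x y < e})"
    "open U = (\<forall>x\<in>U. eventually (\<lambda>(x', y). x' = x \<longrightarrow> y \<in> U) uniformity)"
    by (simp_all add: dist_bop_def sgn_bop_def uniformity_bop_def open_bop_def)
  show "norm T = 0 \<longleftrightarrow> T = 0" "norm (S + T) \<le> norm S + norm T" "norm (r *\<^sub>R T) = \<bar>r\<bar> * norm T"
    by (transfer, simp add: norm_triangle_ineq)+
qed
end

lemma bounded_linear_scaleC_blinfun:
  "bounded_linear (\<lambda>x. c *\<^sub>C blinfun_apply T (x::'a::complex_hilbert) :: 'a)"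
proof (rule bounded_linear_intro[where K = "cmod c * norm T"])
  show "norm (c *\<^sub>C blinfun_apply T x) \<le> norm x * (cmod c * norm T)" for x
    using mult_left_mono[OF norm_blinfun[of T x], of "cmod c"]
    by (simp add: norm_scaleC algebra_simps)
  show "c *\<^sub>C blinfun_apply T (r *\<^sub>R x) = r *\<^sub>R (c *\<^sub>C blinfun_apply T x)" for r x
    unfolding blinfun.scaleR_right by (simp add: scaleR_scaleC scaleC_scaleC mult.commute)
qed (simp add: blinfun.bilinear_simps scaleC_add_right)

instantiation bop :: (complex_hilbert) complex_vector
begin
lift_definition scaleC_bop :: "complex \<Rightarrow> 'a bop \<Rightarrow> 'a bop" is
  "\<lambda>c T. Blinfun (\<lambda>x. c *\<^sub>C blinfun_apply T x)"
  by (simp add: bounded_linear_Blinfun_apply bounded_linear_scaleC_blinfun scaleC_scaleC mult.commute)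
instance
proof
  fix c d :: complex and r :: real and S T :: "'a bop"
  note * = bounded_linear_Blinfun_apply[OF bounded_linear_scaleC_blinfun]
  show "c *\<^sub>C (S + T) = c *\<^sub>C S + c *\<^sub>C T"
    by transfer (rule blinfun_eqI, simp only: *, simp add: * plus_blinfun.rep_eq scaleC_add_right)
  show "(c + d) *\<^sub>C T = c *\<^sub>C T + d *\<^sub>C T"
    by transfer (rule blinfun_eqI, simp only: *, simp add: * plus_blinfun.rep_eq scaleC_add_left)
  show "c *\<^sub>C (d *\<^sub>C T) = (c * d) *\<^sub>C T"
    by transfer (rule blinfun_eqI, simp only: *, simp add: * scaleC_scaleC)
  show "1 *\<^sub>C T = T"
    by transfer (rule blinfun_eqI, simp only: *, simp add: * scaleC_one)
  show "r *\<^sub>R T = complex_of_real r *\<^sub>C T"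
    by transfer (rule blinfun_eqI, simp only: *, simp add: * scaleR_blinfun.rep_eq scaleR_scaleC)
qed
end

instantiation bop :: (complex_hilbert) "{real_normed_algebra, monoid_mult}"
begin
lift_definition one_bop :: "'a bop" is id_blinfun by simp
lift_definition times_bop :: "'a bop \<Rightarrow> 'a bop \<Rightarrow> 'a bop" is "(o\<^sub>L)" by simp
instance
  by standard (transfer, auto intro!: blinfun_eqI
    simp: blinfun.bilinear_simps norm_blinfun_compose)+
end

definition selfadjoint :: "'a::complex_hilbert bop \<Rightarrow> bool" where
  "selfadjoint X \<longleftrightarrow> (\<forall>x y. cinner (bop_apply X x) y = cinner x (bop_apply X y))"

text \<open>Loewner order. On a complex space, nonnegativity of the quadratic form already forces \<open>Y - X\<close>
  to be self-adjoint.\<close>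

instantiation bop :: (complex_hilbert) ord
begin
definition "(X::'a bop) \<le> Y \<longleftrightarrow> (\<forall>x. cinner (bop_apply (Y - X) x) x \<in> \<real>\<^sub>\<ge>\<^sub>0)"
definition "(X::'a bop) < Y \<longleftrightarrow> X \<le> Y \<and> \<not> Y \<le> X"
instance ..
end

definition positive_map :: "('a::complex_hilbert bop \<Rightarrow> 'a bop) \<Rightarrow> bool" where
  "positive_map \<Phi> \<longleftrightarrow> clinear_map \<Phi> \<and> (\<forall>X. 0 \<le> X \<longrightarrow> 0 \<le> \<Phi> X)"

definition spectrum :: "'a::complex_hilbert bop \<Rightarrow> complex set" where
  "spectrum X = {z. \<not> (\<exists>Y. (X - z *\<^sub>C 1) * Y = 1 \<and> Y * (X - z *\<^sub>C 1) = 1)}"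

definition poly_op :: "real poly \<Rightarrow> 'a::complex_hilbert bop \<Rightarrow> 'a bop" where
  "poly_op p X = (\<Sum>i\<le>degree p. coeff p i *\<^sub>R X ^ i)"

text \<open>The continuous functional calculus of a self-adjoint operator \<open>X\<close>: \<open>f(X)\<close> is the norm limit of
  \<open>p\<^sub>k(X)\<close> for real polynomials \<open>p\<^sub>k\<close> converging to \<open>f\<close> uniformly on the (real) spectrum of \<open>X\<close>.
  Meaningful only if \<open>X\<close> is self-adjoint and \<open>f\<close> is continuous on the spectrum.\<close>

definition cfc :: "(real \<Rightarrow> real) \<Rightarrow> 'a::complex_hilbert bop \<Rightarrow> 'a bop" where
  "cfc f X = (THE T. \<exists>p :: nat \<Rightarrow> real poly.
     uniform_limit {t. complex_of_real t \<in> spectrum X} (\<lambda>k. poly (p k)) f sequentially \<and>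
     (\<lambda>k. poly_op (p k) X) \<longlonglongrightarrow> T)"

definition log_convex_on :: "real set \<Rightarrow> (real \<Rightarrow> real) \<Rightarrow> bool" where
  "log_convex_on A f \<longleftrightarrow> (\<forall>x\<in>A. 0 < f x) \<and> convex_on A (\<lambda>x. ln (f x))"

definition Kconst :: "(real \<Rightarrow> real) \<Rightarrow> real \<Rightarrow> real \<Rightarrow> real" where
  "Kconst f m M = (f ((m + M) / 2))\<^sup>2 / (f m * f M)"

definition tilde :: "real \<Rightarrow> real \<Rightarrow> real \<Rightarrow> real" where
  "tilde m M t = 1 / 2 - 1 / (M - m) * \<bar>t - (m + M) / 2\<bar>"

end

theory Submission
  imports Defs "HOL-Computational_Algebra.Fundamental_Theorem_Algebra"
begin

text \<open>
  On \<open>[m, M]\<close> there are two scalar inequalities \<open>f \<le> g \<le> L\<close>, where \<open>L\<close> is the chord of \<open>f\<close> over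
  \<open>[m, M]\<close> and \<open>g t = K powr tilde t * f m powr ((M - t)/(M - m)) * f M powr ((t - m)/(M - m))\<close>.
  The function \<open>ln g\<close> interpolates \<open>ln f\<close> linearly between \<open>m\<close>, the midpoint and \<open>M\<close>, which by
  convexity gives \<open>f \<le> g\<close> (\<open>log_convex_le_interpolant\<close>); since \<open>K \<le> 1\<close>, the weighted
  arithmetic-geometric mean inequality gives \<open>g \<le> L\<close> (\<open>interpolant_le_chord\<close>).

  The functional calculus is monotone (\<open>cfc_mono\<close>), so \<open>f(X) \<le> g(X) \<le> L(X)\<close> for every self-adjoint
  \<open>X\<close> whose real spectrum lies in \<open>[m, M]\<close>. This applies to each \<open>B\<^sub>i\<close>, where the inequalities are
  then mapped by \<open>\<Phi>\<^sub>i\<close> and summed, and to \<open>C = M + m - S\<close>: the order bounds \<open>m \<le> B\<^sub>i \<le> M\<close> pass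
  through the positive maps to \<open>S\<close> and hence to \<open>C\<close>, and they confine the real spectrum of \<open>C\<close>
  (\<open>real_spectrum_bounds\<close>). Both halves of the middle expression thus contain the same function
  \<open>g\<close>. As \<open>L\<close> is affine and \<open>\<Sum> \<Phi>\<^sub>i(1) = 1\<close>, the upper bound becomes
  \<open>L(S) + L(M + m - S) = L(m) + L(M) = f m + f M\<close>.

  What carries the functional calculus is \<open>poly_op_nonneg\<close>: a real polynomial \<open>p \<ge> 0\<close> on the real
  spectrum of a self-adjoint \<open>X\<close> satisfies \<open>p(X) \<ge> 0\<close>. If not, the infimum \<open>a < 0\<close> of the quadratic
  form of \<open>p(X)\<close> is an approximate eigenvalue (\<open>nonneg_if_bounded_below\<close>); but \<open>p - a\<close> has no zero
  on the spectrum, and its real linear and quadratic factors are all bounded below at \<open>X\<close>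
  (\<open>poly_op_bounded_below\<close>). Applied to \<open>c - p\<close> and \<open>c + p\<close> this bounds \<open>\<parallel>p(X)\<parallel>\<close> by the maximum of
  \<open>\<bar>p\<bar>\<close> on the spectrum, so limits of polynomials in \<open>X\<close> exist and are unique (\<open>cfc_limit\<close>).
\<close>

section \<open>The real inner product and the Loewner order\<close>

text \<open>For self-adjoint operators the quadratic form is real, so the estimates below can be made with
  the real part of the inner product, for which scaling and symmetry involve no conjugation.\<close>

definition rinner :: "'a::complex_hilbert \<Rightarrow> 'a \<Rightarrow> real" where
  "rinner x y = Re (cinner x y)"

lemma rinner_commute: "rinner x y = rinner y x"
  unfolding rinner_def by (subst cinner_commute) simp

lemma rinner_add_left: "rinner (x + y) z = rinner x z + rinner y z"
  by (simp add: rinner_def cinner_add_left)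

lemma rinner_scaleR_left: "rinner (r *\<^sub>R x) y = r * rinner x y"
  by (simp add: rinner_def scaleR_scaleC cinner_scaleC_left)

lemma rinner_add_right: "rinner x (y + z) = rinner x y + rinner x z"
  by (metis rinner_commute rinner_add_left)

lemma rinner_scaleR_right: "rinner x (r *\<^sub>R y) = r * rinner x y"
  by (metis rinner_commute rinner_scaleR_left)

lemma rinner_minus_left: "rinner (- x) y = - rinner x y"
  using rinner_scaleR_left[of "-1" x y] by simp

lemma rinner_minus_right: "rinner x (- y) = - rinner x y"
  by (metis rinner_commute rinner_minus_left)

lemma rinner_diff_left: "rinner (x - y) z = rinner x z - rinner y z"
  using rinner_add_left[of x "-y" z] by (simp add: rinner_minus_left)

lemma rinner_diff_right: "rinner x (y - z) = rinner x y - rinner x z"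
  by (metis rinner_commute rinner_diff_left)

lemma rinner_zero: "rinner 0 x = 0" "rinner x 0 = 0"
  using rinner_scaleR_left[of 0 x x] rinner_scaleR_right[of x 0 x] by simp_all

lemmas rinner_simps = rinner_zero rinner_add_left rinner_scaleR_left rinner_add_right rinner_scaleR_right
  rinner_minus_left rinner_minus_right rinner_diff_left rinner_diff_right

lemma rinner_self: "rinner x x = (norm x)\<^sup>2"
  using cinner_self_nonneg[of x]
  by (simp add: rinner_def norm_eq_sqrt_cinner complex_nonneg_Reals_iff)

lemma rinner_cauchy_schwarz: "\<bar>rinner x y\<bar> \<le> norm x * norm y"
proof -
  have *: "rinner x y \<le> norm x * norm y" for x y :: 'a
  proof (cases "x = 0 \<or> y = 0")
    case True
    then show ?thesis
      by (auto simp: rinner_zero)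
  next
    case False
    have "0 \<le> rinner (norm y *\<^sub>R x - norm x *\<^sub>R y) (norm y *\<^sub>R x - norm x *\<^sub>R y)"
      by (simp add: rinner_self)
    also have "\<dots> = 2 * (norm x * norm y) * (norm x * norm y - rinner x y)"
      unfolding rinner_simps
      by (simp add: rinner_self rinner_commute[of y x] algebra_simps power2_eq_square)
    finally have "0 \<le> 2 * (norm x * norm y) * (norm x * norm y - rinner x y)" .
    moreover have "0 < 2 * (norm x * norm y)"
      using False by simp
    ultimately have "0 \<le> norm x * norm y - rinner x y"
      by (metis mult_pos_neg not_le)
    then show ?thesis by simp
  qed
  show ?thesis
    using *[of x y] *[of "-x" y] by (simp add: rinner_minus_left)
qed

lemma bop_apply_simps [simp]:
  "bop_apply (S + T) x = bop_apply S x + bop_apply T x"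
  "bop_apply (S - T) x = bop_apply S x - bop_apply T x"
  "bop_apply (- T) x = - bop_apply T x"
  "bop_apply (r *\<^sub>R T) x = r *\<^sub>R bop_apply T x"
  "bop_apply (S * T) x = bop_apply S (bop_apply T x)"
  "bop_apply 1 x = x"
  "bop_apply 0 x = 0"
  by (transfer; simp add: blinfun.bilinear_simps)+

lemma bop_apply_linear:
  "bop_apply T (x + y) = bop_apply T x + bop_apply T y"
  "bop_apply T (x - y) = bop_apply T x - bop_apply T y"
  "bop_apply T (r *\<^sub>R x) = r *\<^sub>R bop_apply T x"
  "bop_apply T 0 = 0"
  "bop_apply T (c *\<^sub>C x) = c *\<^sub>C bop_apply T x"
  by (transfer; simp add: blinfun.bilinear_simps)+

lemma bop_eqI: "(\<And>x. bop_apply S x = bop_apply T x) \<Longrightarrow> S = T"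
  by transfer (rule blinfun_eqI)

lemma norm_bop_apply: "norm (bop_apply T x) \<le> norm T * norm x"
  by transfer (rule norm_blinfun)

lemma norm_bop_bound:
  "0 \<le> b \<Longrightarrow> (\<And>x. norm (bop_apply T x) \<le> b * norm x) \<Longrightarrow> norm T \<le> b"
  by transfer (rule norm_blinfun_bound)

lemma selfadjoint_rinner:
  "selfadjoint T \<Longrightarrow> rinner (bop_apply T x) y = rinner x (bop_apply T y)"
  by (simp add: selfadjoint_def rinner_def)

lemma cinner_eq_rinner: "cinner x y = Complex (rinner x y) (rinner x (\<i> *\<^sub>C y))"
proof -
  have "cinner x (\<i> *\<^sub>C y) = - \<i> * cinner x y"
    by (metis cinner_commute cinner_scaleC_left complex_cnj_i complex_cnj_mult)
  then show ?thesis
    by (simp add: complex_eq_iff rinner_def)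
qed

lemma selfadjointI:
  assumes "\<And>x y. rinner (bop_apply T x) y = rinner x (bop_apply T y)"
  shows "selfadjoint T"
  unfolding selfadjoint_def
  by (simp add: cinner_eq_rinner assms bop_apply_linear)

text \<open>On a complex space, polarization recovers an operator from its quadratic form, so a real
  quadratic form forces self-adjointness.\<close>

lemma bop_nonneg_iff:
  "0 \<le> T \<longleftrightarrow> selfadjoint T \<and> (\<forall>x. 0 \<le> rinner (bop_apply T x) x)"
proof safe
  assume T: "0 \<le> T"
  then have form: "cinner (bop_apply T x) x \<in> \<real>\<^sub>\<ge>\<^sub>0" for x
    by (simp add: less_eq_bop_def)
  show "0 \<le> rinner (bop_apply T x) x" for x
    using form[of x] by (simp add: rinner_def complex_nonneg_Reals_iff)
  have im: "rinner (bop_apply T x) (\<i> *\<^sub>C x) = 0" for x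
    using form[of x] by (simp add: cinner_eq_rinner complex_nonneg_Reals_iff)
  have ii: "\<i> *\<^sub>C \<i> *\<^sub>C z = - z" for z :: 'a
    by (metis i_squared scaleC_scaleC scaleR_minus1_left scaleR_scaleC of_real_1 of_real_minus)
  have iso: "rinner (\<i> *\<^sub>C x) (\<i> *\<^sub>C y) = rinner x y" for x y :: 'a
    unfolding rinner_def cinner_scaleC_left
    by (subst (1 2) cinner_commute) (simp add: cinner_scaleC_left)
  show "selfadjoint T"
  proof (rule selfadjointI)
    fix x y
    \<comment> \<open>Polarize the vanishing imaginary part at the pair \<open>x\<close>, \<open>\<i> y\<close>.\<close>
    have "rinner (bop_apply T (x + \<i> *\<^sub>C y)) (\<i> *\<^sub>C (x + \<i> *\<^sub>C y)) = 0"
      by (rule im)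
    then have "rinner (bop_apply T x) (\<i> *\<^sub>C \<i> *\<^sub>C y) + rinner (\<i> *\<^sub>C bop_apply T y) (\<i> *\<^sub>C x) = 0"
      using im[of x] im[of "\<i> *\<^sub>C y"]
      by (simp add: bop_apply_linear scaleC_add_right rinner_simps)
    then show "rinner (bop_apply T x) y = rinner x (bop_apply T y)"
      by (simp add: ii iso rinner_minus_right rinner_commute[of x])
  qed
next
  assume T: "selfadjoint T" "\<forall>x. 0 \<le> rinner (bop_apply T x) x"
  have "cnj (cinner (bop_apply T x) x) = cinner (bop_apply T x) x" for x
    using T(1) by (metis cinner_commute selfadjoint_def)
  then have "Im (cinner (bop_apply T x) x) = 0" for x
    by (metis cnj.simps(2) equal_neg_zero)
  then show "0 \<le> T"
    using T(2) by (auto simp: less_eq_bop_def complex_nonneg_Reals_iff rinner_def)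
qed

lemma bop_le_iff_diff: "X \<le> Y \<longleftrightarrow> 0 \<le> Y - (X::'a::complex_hilbert bop)"
  by (simp add: less_eq_bop_def)

lemma selfadjoint_closed:
  "selfadjoint (0::'a::complex_hilbert bop)"
  "selfadjoint (1::'a bop)"
  "selfadjoint S \<Longrightarrow> selfadjoint T \<Longrightarrow> selfadjoint (S + T)"
  "selfadjoint S \<Longrightarrow> selfadjoint T \<Longrightarrow> selfadjoint (S - T)"
  "selfadjoint T \<Longrightarrow> selfadjoint (r *\<^sub>R T)"
  for S T :: "'a::complex_hilbert bop"
  by (auto intro!: selfadjointI simp: rinner_simps selfadjoint_rinner bop_apply_linear)

lemma bop_nonneg_add: "0 \<le> S \<Longrightarrow> 0 \<le> T \<Longrightarrow> 0 \<le> S + (T::'a::complex_hilbert bop)"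
  by (auto simp: bop_nonneg_iff selfadjoint_closed rinner_simps)

lemma bop_nonneg_sum:
  fixes F :: "'i \<Rightarrow> 'a::complex_hilbert bop"
  shows "(\<And>i. i \<in> I \<Longrightarrow> 0 \<le> F i) \<Longrightarrow> 0 \<le> sum F I"
proof (induction I rule: infinite_finite_induct)
  case (insert i I)
  then show ?case by (simp add: bop_nonneg_add)
qed (simp_all add: bop_nonneg_iff selfadjoint_closed rinner_zero)

lemma bop_add_mono: "W \<le> X \<Longrightarrow> Y \<le> Z \<Longrightarrow> W + Y \<le> X + (Z::'a::complex_hilbert bop)"
  using bop_nonneg_add[of "X - W" "Z - Y"]
  by (simp add: bop_le_iff_diff[of W] bop_le_iff_diff[of Y] bop_le_iff_diff[of "W + Y"] algebra_simps)

lemma bop_sum_mono: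
  fixes F G :: "'i \<Rightarrow> 'a::complex_hilbert bop"
  assumes "\<And>i. i \<in> I \<Longrightarrow> F i \<le> G i"
  shows "sum F I \<le> sum G I"
  using bop_nonneg_sum[of I "\<lambda>i. G i - F i"] assms
  by (simp add: bop_le_iff_diff[of "F _"] bop_le_iff_diff[of "sum F I"] sum_subtractf)

lemma bop_nonneg_limit:
  fixes T :: "nat \<Rightarrow> 'a::complex_hilbert bop"
  assumes "T \<longlonglongrightarrow> L" and nonneg: "\<And>k. 0 \<le> T k"
  shows "0 \<le> L"
proof -
  have lim: "(\<lambda>k. rinner (bop_apply (T k) x) y) \<longlonglongrightarrow> rinner (bop_apply L x) y" for x y
  proof (rule LIM_zero_cancel, rule Lim_null_comparison, rule always_eventually, rule allI)
    show "norm (rinner (bop_apply (T k) x) y - rinner (bop_apply L x) y) \<le> norm (T k - L) * (norm x * norm y)" for k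
      using rinner_cauchy_schwarz[of "bop_apply (T k - L) x" y]
        mult_right_mono[OF norm_bop_apply[of "T k - L" x], of "norm y"]
      by (simp add: rinner_simps mult.assoc)
    show "(\<lambda>k. norm (T k - L) * (norm x * norm y)) \<longlonglongrightarrow> 0"
      by (rule tendsto_mult_left_zero[OF tendsto_norm_zero[OF LIM_zero[OF assms(1)]]])
  qed
  have "selfadjoint L"
  proof (rule selfadjointI)
    fix x y
    have "(\<lambda>k. rinner (bop_apply (T k) x) y) \<longlonglongrightarrow> rinner x (bop_apply L y)"
      using lim[of y x] nonneg by (simp add: rinner_commute[of x] bop_nonneg_iff selfadjoint_rinner)
    then show "rinner (bop_apply L x) y = rinner x (bop_apply L y)"
      using LIMSEQ_unique lim by blast
  qed
  moreover have "0 \<le> rinner (bop_apply L x) x" for x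
    by (rule LIMSEQ_le_const[OF lim]) (use nonneg in \<open>auto simp: bop_nonneg_iff\<close>)
  ultimately show ?thesis by (simp add: bop_nonneg_iff)
qed

text \<open>The quadratic form controls the norm of a self-adjoint operator, because
  \<open>4 Re \<langle>Tx, y\<rangle>\<close> is the difference of the form at \<open>x + y\<close> and at \<open>x - y\<close>.\<close>

lemma norm_le_of_form_bounds:
  fixes T :: "'a::complex_hilbert bop"
  assumes "selfadjoint T" "0 \<le> c" "0 \<le> c *\<^sub>R 1 - T" "0 \<le> c *\<^sub>R 1 + T"
  shows "norm T \<le> c"
proof (rule norm_bop_bound[OF assms(2)])
  fix x
  have form: "\<bar>rinner (bop_apply T z) z\<bar> \<le> c * (norm z)\<^sup>2" for z
    using assms(3,4) by (simp add: bop_nonneg_iff rinner_simps rinner_self abs_le_iff) (smt (verit))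
  show "norm (bop_apply T x) \<le> c * norm x"
  proof (cases "x = 0 \<or> bop_apply T x = 0")
    case True
    then show ?thesis using assms(2) by (auto simp: bop_apply_linear)
  next
    case False
    define s where "s = norm (bop_apply T x) / norm x"
    have s: "0 < s" using False by (simp add: s_def)
    \<comment> \<open>Scaling \<open>x\<close> to the length of \<open>Tx\<close> makes the parallelogram law sharp.\<close>
    define u where "u = s *\<^sub>R x"
    define y where "y = bop_apply T x"
    have nu: "norm u = norm y" using False by (simp add: u_def y_def s_def)
    have "4 * rinner (bop_apply T u) y
        = rinner (bop_apply T (u + y)) (u + y) - rinner (bop_apply T (u - y)) (u - y)"
      using selfadjoint_rinner[OF assms(1), of y u]
      by (simp add: bop_apply_linear rinner_simps rinner_commute[of y])
    also have "\<dots> \<le> c * (norm (u + y))\<^sup>2 + c * (norm (u - y))\<^sup>2"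
      using form[of "u + y"] form[of "u - y"] by (simp add: abs_le_iff)
    also have "\<dots> = c * (2 * (norm u)\<^sup>2 + 2 * (norm y)\<^sup>2)"
      by (simp add: rinner_self[symmetric] rinner_simps algebra_simps)
    finally have "rinner (bop_apply T u) y \<le> c * (norm y)\<^sup>2"
      by (simp add: nu)
    moreover have "rinner (bop_apply T u) y = s * (norm y)\<^sup>2"
      by (simp add: u_def bop_apply_linear y_def[symmetric] rinner_scaleR_left rinner_self)
    ultimately have "s \<le> c" using False by (simp add: y_def)
    then show ?thesis using False by (simp add: s_def field_simps)
  qed
qed

section \<open>Completeness and invertibility of coercive operators\<close>

instance bop :: (complex_hilbert) banach
proof
  fix X :: "nat \<Rightarrow> 'a bop"
  assume "Cauchy X"
  then have "Cauchy (\<lambda>n. bop_blinfun (X n))"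
    by (simp add: Cauchy_def dist_bop_def dist_norm norm_bop.rep_eq minus_bop.rep_eq)
  then obtain L where L: "(\<lambda>n. bop_blinfun (X n)) \<longlonglongrightarrow> L"
    using Cauchy_convergent convergent_def by blast
  have "blinfun_apply L (c *\<^sub>C x) = c *\<^sub>C blinfun_apply L x" for c x
  proof (rule LIMSEQ_unique)
    have lim: "(\<lambda>n. bop_apply (X n) x) \<longlonglongrightarrow> blinfun_apply L x" for x
      unfolding bop_apply.rep_eq by (intro blinfun.tendsto L tendsto_const)
    show "(\<lambda>n. bop_apply (X n) (c *\<^sub>C x)) \<longlonglongrightarrow> blinfun_apply L (c *\<^sub>C x)"
      by (rule lim)
    have "(\<lambda>n. cmod c * norm (bop_apply (X n) x - blinfun_apply L x)) \<longlonglongrightarrow> 0"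
      using tendsto_mult_right_zero[OF tendsto_norm_zero[OF LIM_zero[OF lim[of x]]]] .
    then have "(\<lambda>n. norm (bop_apply (X n) (c *\<^sub>C x) - c *\<^sub>C blinfun_apply L x)) \<longlonglongrightarrow> 0"
      by (simp add: bop_apply_linear scaleC_diff_right[symmetric] norm_scaleC)
    then show "(\<lambda>n. bop_apply (X n) (c *\<^sub>C x)) \<longlonglongrightarrow> c *\<^sub>C blinfun_apply L x"
      by (simp add: tendsto_norm_zero_iff LIM_zero_iff)
  qed
  then obtain T where T: "bop_blinfun T = L"
    using Abs_bop_inverse[of L] by auto
  have "(\<lambda>n. norm (X n - T)) \<longlonglongrightarrow> 0"
    using tendsto_norm_zero[OF LIM_zero[OF L]]
    by (simp add: norm_bop.rep_eq minus_bop.rep_eq T)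
  then show "convergent X"
    by (auto simp: convergent_def tendsto_norm_zero_iff LIM_zero_iff)
qed

lemma neumann_inverse:
  fixes E :: "'a::complex_hilbert bop"
  assumes "norm E < 1"
  shows "\<exists>Y. (1 - E) * Y = 1 \<and> Y * (1 - E) = 1"
proof -
  have bound: "norm (E ^ n) \<le> norm (1::'a bop) * norm E ^ n" for n
  proof (induction n)
    case (Suc n)
    have "norm (E ^ Suc n) \<le> norm E * norm (E ^ n)" by (simp add: norm_mult_ineq)
    also have "\<dots> \<le> norm E * (norm (1::'a bop) * norm E ^ n)"
      by (intro mult_left_mono Suc.IH) simp
    finally show ?case by (simp add: algebra_simps)
  qed simp
  have sm: "summable (\<lambda>n. E ^ n)"
    by (rule summable_comparison_test'[where N = 0 and g = "\<lambda>n. norm (1::'a bop) * norm E ^ n"])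
      (use bound assms in \<open>auto intro!: summable_mult summable_geometric\<close>)
  define Y where "Y = (\<Sum>n. E ^ n)"
  have split: "Y = 1 + (\<Sum>n. E ^ Suc n)"
    unfolding Y_def using suminf_split_head[OF sm] by simp
  have l: "(\<Sum>n. E ^ Suc n) = E * Y"
    unfolding Y_def power_Suc by (rule bounded_linear.suminf[OF bounded_linear_mult_right sm, symmetric])
  have r: "(\<Sum>n. E ^ Suc n) = Y * E"
    unfolding Y_def power_Suc2 by (rule bounded_linear.suminf[OF bounded_linear_mult_left sm, symmetric])
  have "Y - E * Y = 1" "Y - Y * E = 1"
    using split l r by (metis add_diff_cancel_right')+
  moreover have "(1 - E) * Y = Y - E * Y" "Y * (1 - E) = Y - Y * E"
    by (rule bop_eqI; simp add: bop_apply_linear)+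
  ultimately show ?thesis by auto
qed

text \<open>The Lax--Milgram theorem for operators: for small \<open>\<tau>\<close> the operator \<open>1 - \<tau> A\<close> is a strict
  contraction, so \<open>\<tau> A\<close> is inverted by a Neumann series.\<close>

lemma coercive_invertible:
  fixes A :: "'a::complex_hilbert bop"
  assumes d: "0 < d" and co: "\<And>x. d * (norm x)\<^sup>2 \<le> rinner (bop_apply A x) x"
  shows "\<exists>Y. A * Y = 1 \<and> Y * A = 1"
proof -
  define \<tau> where "\<tau> = d / ((norm A)\<^sup>2 + d\<^sup>2)"
  have D: "0 < (norm A)\<^sup>2 + d\<^sup>2" using d by (simp add: add_nonneg_pos)
  have \<tau>: "0 < \<tau>" "\<tau> * (norm A)\<^sup>2 \<le> d" "\<tau> * d \<le> 1"
    using d D by (simp_all add: \<tau>_def field_simps power2_eq_square)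
  define E where "E = 1 - \<tau> *\<^sub>R A"
  have "norm E \<le> sqrt (1 - \<tau> * d)"
  proof (rule norm_bop_bound)
    show "0 \<le> sqrt (1 - \<tau> * d)" using \<tau> by simp
    fix x
    have "(norm (bop_apply E x))\<^sup>2
        = (norm x)\<^sup>2 - 2 * \<tau> * rinner (bop_apply A x) x + \<tau> * \<tau> * (norm (bop_apply A x))\<^sup>2"
      unfolding E_def rinner_self[symmetric] bop_apply_simps rinner_simps
      using rinner_commute[of x "bop_apply A x"] by (simp add: algebra_simps)
    also have "\<dots> \<le> (norm x)\<^sup>2 - 2 * \<tau> * (d * (norm x)\<^sup>2) + \<tau> * \<tau> * ((norm A)\<^sup>2 * (norm x)\<^sup>2)"
    proof -
      have "(norm (bop_apply A x))\<^sup>2 \<le> (norm A)\<^sup>2 * (norm x)\<^sup>2"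
        using power_mono[OF norm_bop_apply[of A x], of 2] by (simp add: power_mult_distrib)
      then show ?thesis
        using co[of x] \<tau>(1) by (intro add_mono diff_mono mult_left_mono) simp_all
    qed
    also have "\<dots> \<le> (1 - \<tau> * d) * (norm x)\<^sup>2"
    proof -
      have "\<tau> * (\<tau> * (norm A)\<^sup>2) * (norm x)\<^sup>2 \<le> \<tau> * d * (norm x)\<^sup>2"
        using \<tau> by (intro mult_right_mono mult_left_mono) auto
      then show ?thesis by (simp add: algebra_simps)
    qed
    finally have "(norm (bop_apply E x))\<^sup>2 \<le> (sqrt (1 - \<tau> * d) * norm x)\<^sup>2"
      using \<tau> by (simp add: power_mult_distrib)
    then show "norm (bop_apply E x) \<le> sqrt (1 - \<tau> * d) * norm x"
      by (rule power2_le_imp_le) (use \<tau> in simp)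
  qed
  also have "\<dots> < 1" using \<tau> d by (simp add: real_sqrt_lt_1_iff)
  finally obtain Y where Y: "(1 - E) * Y = 1" "Y * (1 - E) = 1"
    using neumann_inverse by blast
  have "A * (\<tau> *\<^sub>R Y) = (1 - E) * Y" "(\<tau> *\<^sub>R Y) * A = Y * (1 - E)"
    by (rule bop_eqI; simp add: E_def bop_apply_linear)+
  with Y show ?thesis by metis
qed

lemma not_in_spectrum_iff:
  "complex_of_real r \<notin> spectrum X \<longleftrightarrow> (\<exists>Y. (X - r *\<^sub>R 1) * Y = 1 \<and> Y * (X - r *\<^sub>R 1) = 1)"
  by (simp add: spectrum_def scaleR_scaleC)

lemma real_spectrum_bounds:
  fixes X :: "'a::complex_hilbert bop"
  assumes "m *\<^sub>R 1 \<le> X" "X \<le> M *\<^sub>R 1" "complex_of_real r \<in> spectrum X"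
  shows "r \<in> {m..M}"
proof (rule ccontr)
  have lo: "m * (norm x)\<^sup>2 \<le> rinner (bop_apply X x) x"
    and hi: "rinner (bop_apply X x) x \<le> M * (norm x)\<^sup>2" for x
    using assms(1,2)
    by (auto simp: bop_le_iff_diff[of _ X] bop_le_iff_diff[of X] bop_nonneg_iff rinner_simps rinner_self)
  assume "r \<notin> {m..M}"
  then consider "r < m" | "M < r" by fastforce
  then have "\<exists>Y. (X - r *\<^sub>R 1) * Y = 1 \<and> Y * (X - r *\<^sub>R 1) = 1"
  proof cases
    case 1
    then show ?thesis
      by (intro coercive_invertible[where d = "m - r"])
        (use lo in \<open>auto simp: rinner_simps rinner_self algebra_simps\<close>)
  next
    case 2
    then have "\<exists>Y. (r *\<^sub>R 1 - X) * Y = 1 \<and> Y * (r *\<^sub>R 1 - X) = 1"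
      by (intro coercive_invertible[where d = "r - M"])
        (use hi in \<open>auto simp: rinner_simps rinner_self algebra_simps\<close>)
    then obtain Y where "(r *\<^sub>R 1 - X) * Y = 1" "Y * (r *\<^sub>R 1 - X) = 1" by blast
    moreover have "(X - r *\<^sub>R 1) * (- Y) = (r *\<^sub>R 1 - X) * Y" "(- Y) * (X - r *\<^sub>R 1) = Y * (r *\<^sub>R 1 - X)"
      by (simp_all add: algebra_simps)
    ultimately show ?thesis by metis
  qed
  then show False using assms(3) not_in_spectrum_iff by blast
qed

section \<open>Polynomials of a self-adjoint operator\<close>

lemma poly_op_eq_sum:
  assumes "degree p \<le> N"
  shows "poly_op p X = (\<Sum>i\<le>N. coeff p i *\<^sub>R X ^ i)"
  unfolding poly_op_def
  by (rule sum.mono_neutral_left) (use assms in \<open>auto simp: coeff_eq_0\<close>)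

lemma poly_op_add: "poly_op (p + q) X = poly_op p X + poly_op q X"
proof -
  define N where "N = max (degree p) (degree q)"
  have "degree (p + q) \<le> N" "degree p \<le> N" "degree q \<le> N"
    by (auto simp: N_def degree_add_le)
  then show ?thesis
    by (simp add: poly_op_eq_sum[where N = N] scaleR_add_left sum.distrib)
qed

lemma poly_op_smult: "poly_op (smult c p) X = c *\<^sub>R poly_op p X"
proof -
  have "degree (smult c p) \<le> degree p" by simp
  then show ?thesis
    by (simp add: poly_op_eq_sum[where N = "degree p"] scaleR_sum_right)
qed

lemma poly_op_diff: "poly_op (p - q) X = poly_op p X - poly_op q X"
  using poly_op_add[of p "smult (-1) q" X] unfolding poly_op_smult by simp

lemma poly_op_0 [simp]: "poly_op 0 X = 0"
  by (simp add: poly_op_def)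

lemma poly_op_pCons: "poly_op (pCons a p) X = a *\<^sub>R 1 + X * poly_op p X"
proof -
  have "degree (pCons a p) \<le> Suc (degree p)" by (simp add: degree_pCons_le)
  then have "poly_op (pCons a p) X = (\<Sum>i\<le>Suc (degree p). coeff (pCons a p) i *\<^sub>R X ^ i)"
    by (rule poly_op_eq_sum)
  also have "\<dots> = a *\<^sub>R 1 + (\<Sum>i\<le>degree p. coeff p i *\<^sub>R (X * X ^ i))"
    by (subst sum.atMost_Suc_shift) simp
  finally show ?thesis
    by (simp add: poly_op_def sum_distrib_left)
qed

lemma poly_op_mult: "poly_op (p * q) X = poly_op p X * poly_op q X"
  by (induction p)
    (simp_all add: poly_op_pCons poly_op_add poly_op_smult distrib_right mult.assoc)

lemma poly_op_commute: "X * poly_op p X = poly_op p X * X"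
proof -
  have "poly_op ([:0, 1:] * p) X = poly_op (p * [:0, 1:]) X" by (simp only: mult.commute)
  then show ?thesis by (simp only: poly_op_mult) (simp add: poly_op_pCons)
qed

lemma selfadjoint_poly_op:
  assumes "selfadjoint X"
  shows "selfadjoint (poly_op p X)"
proof (induction p)
  case (pCons a p)
  have "selfadjoint (X * poly_op p X)"
    using assms pCons.IH poly_op_commute[of X p]
    by (intro selfadjointI) (metis bop_apply_simps(5) selfadjoint_rinner)
  then show ?case
    by (simp add: poly_op_pCons selfadjoint_closed)
qed (simp add: selfadjoint_closed)

text \<open>A substitute for invertibility that passes to products, excludes approximate eigenvalues, and
  for \<open>(X - a)\<^sup>2 + b\<^sup>2\<close> follows from the quadratic form alone, without constructing an inverse.\<close>

definition bounded_below :: "'a::complex_hilbert bop \<Rightarrow> bool" where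
  "bounded_below T \<longleftrightarrow> (\<exists>c>0. \<forall>x. c * norm x \<le> norm (bop_apply T x))"

lemma bounded_below_mult:
  assumes "bounded_below S" "bounded_below T"
  shows "bounded_below (S * T)"
proof -
  obtain c d where c: "0 < c" "\<And>x. c * norm x \<le> norm (bop_apply S x)"
    and d: "0 < d" "\<And>x. d * norm x \<le> norm (bop_apply T x)"
    using assms unfolding bounded_below_def by blast
  have "c * d * norm x \<le> norm (bop_apply (S * T) x)" for x
    using mult_left_mono[OF d(2)[of x] less_imp_le[OF c(1)]] c(2)[of "bop_apply T x"]
    by (simp add: mult.assoc)
  then show ?thesis
    unfolding bounded_below_def using c(1) d(1) by (intro exI[of _ "c * d"]) simp
qed

lemma bounded_below_if_left_inverse:
  assumes "Y * T = 1"
  shows "bounded_below T"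
proof -
  have "1 / (norm Y + 1) * norm x \<le> norm (bop_apply T x)" for x
  proof -
    have "norm x = norm (bop_apply Y (bop_apply T x))"
      using assms by (metis bop_apply_simps(5,6))
    also have "\<dots> \<le> norm Y * norm (bop_apply T x)" by (rule norm_bop_apply)
    also have "\<dots> \<le> (norm Y + 1) * norm (bop_apply T x)" by (simp add: mult_right_mono)
    finally show ?thesis
      by (simp add: pos_divide_le_eq add_nonneg_pos mult.commute)
  qed
  then show ?thesis
    unfolding bounded_below_def by (intro exI[of _ "1 / (norm Y + 1)"]) (auto simp: add_nonneg_pos)
qed

lemma bounded_below_if_coercive:
  assumes "0 < d" "\<And>x. d * (norm x)\<^sup>2 \<le> rinner (bop_apply T x) x"
  shows "bounded_below T"
proof -
  have "d * norm x \<le> norm (bop_apply T x)" for x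
  proof (cases "x = 0")
    case False
    have "d * norm x * norm x \<le> norm (bop_apply T x) * norm x"
      using assms(2)[of x] rinner_cauchy_schwarz[of "bop_apply T x" x]
      by (simp add: power2_eq_square)
    then show ?thesis using False by simp
  qed simp
  then show ?thesis using assms(1) unfolding bounded_below_def by blast
qed

lemma map_poly_of_real_add:
  "map_poly complex_of_real (p + q) = map_poly complex_of_real p + map_poly complex_of_real q"
  by (rule poly_eqI) (simp add: coeff_map_poly)

lemma map_poly_of_real_mult:
  "map_poly complex_of_real (p * q) = map_poly complex_of_real p * map_poly complex_of_real q"
  by (rule poly_eqI) (simp add: coeff_map_poly coeff_mult)

lemma poly_map_of_real:
  "poly (map_poly complex_of_real p) (complex_of_real t) = complex_of_real (poly p t)"
  by (induction p) (simp_all add: map_poly_pCons)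

text \<open>A nonreal root of a real polynomial comes with its conjugate; dividing by the quadratic with
  these roots leaves a linear remainder that vanishes at a nonreal point, hence is zero.\<close>

lemma real_poly_nonreal_root_dvd:
  fixes p :: "real poly"
  assumes "poly (map_poly complex_of_real p) (Complex a b) = 0" "b \<noteq> 0"
  shows "[:a\<^sup>2 + b\<^sup>2, - 2 * a, 1:] dvd p"
proof -
  let ?z = "Complex a b"
  define d where "d = [:a\<^sup>2 + b\<^sup>2, - 2 * a, 1:]"
  define r where "r = p mod d"
  have dz: "poly (map_poly complex_of_real d) ?z = 0"
    by (simp add: d_def map_poly_pCons complex_eq_iff power2_eq_square algebra_simps)
  have "map_poly complex_of_real p
      = map_poly complex_of_real (p div d) * map_poly complex_of_real d + map_poly complex_of_real r"
    unfolding r_def by (metis div_mult_mod_eq map_poly_of_real_add map_poly_of_real_mult)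
  then have rz: "poly (map_poly complex_of_real r) ?z = 0"
    using assms(1) dz by simp
  have "degree r < 2"
    using degree_mod_less'[of d p] by (cases "r = 0") (auto simp: r_def d_def)
  then obtain r0 r1 where r: "r = [:r0, r1:]"
  proof -
    obtain r0 q where q: "r = pCons r0 q" by (cases r)
    with \<open>degree r < 2\<close> have "degree q = 0" by (auto split: if_splits)
    then obtain r1 where "q = [:r1:]" by (metis degree_eq_zeroE)
    with q that show ?thesis by blast
  qed
  have "r1 * b = 0" "r0 + r1 * a = 0"
    using rz by (simp_all add: r map_poly_pCons complex_eq_iff algebra_simps)
  then have "r = 0" using assms(2) r by simp
  then show ?thesis unfolding d_def[symmetric] r_def by (simp add: dvd_eq_mod_eq_0)
qed

text \<open>The part of the spectral mapping theorem that is needed. By the fundamental theorem of algebra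
  \<open>q\<close> splits into linear factors \<open>t - r\<close>, where \<open>r\<close> is not in the spectrum, and quadratic ones
  \<open>(t - a)\<^sup>2 + b\<^sup>2\<close>; at \<open>X\<close> the latter are coercive.\<close>

lemma poly_op_bounded_below:
  fixes X :: "'a::complex_hilbert bop"
  assumes X: "selfadjoint X"
    and "q \<noteq> 0" "\<And>t. complex_of_real t \<in> spectrum X \<Longrightarrow> poly q t \<noteq> 0"
  shows "bounded_below (poly_op q X)"
  using assms(2,3)
proof (induction "degree q" arbitrary: q rule: less_induct)
  case less
  show ?case
  proof (cases "degree q = 0")
    case True
    then obtain c where q: "q = [:c:]" by (metis degree_eq_zeroE)
    with less.prems have "((1 / c) *\<^sub>R 1) * poly_op q X = 1"
      by (intro bop_eqI) (simp add: poly_op_pCons)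
    then show ?thesis by (rule bounded_below_if_left_inverse)
  next
    case False
    then have "degree (map_poly complex_of_real q) \<noteq> 0"
      by (simp add: degree_map_poly)
    then obtain z where z: "poly (map_poly complex_of_real q) z = 0"
      using fundamental_theorem_of_algebra by (metis constant_degree)
    obtain a b where ab: "z = Complex a b" by (cases z)
    define d where "d = (if b = 0 then [:- a, 1:] else [:a\<^sup>2 + b\<^sup>2, - 2 * a, 1:])"
    have "d dvd q"
    proof (cases "b = 0")
      case True
      then have "complex_of_real (poly q a) = 0"
        using z ab poly_map_of_real[of q a] by (simp add: complex_of_real_def)
      then show ?thesis using True by (simp add: d_def poly_eq_0_iff_dvd)
    next
      case False
      then show ?thesis using z ab real_poly_nonreal_root_dvd[of q a b] by (simp add: d_def)
    qed
    then obtain s where q: "q = d * s" by (elim dvdE)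
    have s: "s \<noteq> 0" "d \<noteq> 0" using less.prems(1) q by auto
    have "degree d \<ge> 1" by (simp add: d_def)
    then have "degree s < degree q" using s by (simp add: q degree_mult_eq)
    then have bs: "bounded_below (poly_op s X)"
      using less.hyps[of s] less.prems(2) s(1) by (simp add: q)
    have bd: "bounded_below (poly_op d X)"
    proof (cases "b = 0")
      case True
      then have "poly q a = 0" by (simp add: q d_def)
      then have "complex_of_real a \<notin> spectrum X" using less.prems(2) by blast
      then obtain Y where "Y * (X - a *\<^sub>R 1) = 1" using not_in_spectrum_iff by blast
      moreover have "poly_op d X = X - a *\<^sub>R 1"
        using True by (simp add: d_def poly_op_pCons)
      ultimately show ?thesis by (metis bounded_below_if_left_inverse)
    next
      case False
      have "b\<^sup>2 * (norm x)\<^sup>2 \<le> rinner (bop_apply (poly_op d X) x) x" for x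
      proof -
        define y where "y = bop_apply X x"
        have "bop_apply (poly_op d X) x = (a\<^sup>2 + b\<^sup>2) *\<^sub>R x - (2 * a) *\<^sub>R y + bop_apply X y"
          using False by (simp add: d_def poly_op_pCons bop_apply_linear y_def)
        moreover have "rinner (bop_apply X y) x = rinner y y"
          unfolding y_def by (rule selfadjoint_rinner[OF X])
        ultimately have "rinner (bop_apply (poly_op d X) x) x
            = (a\<^sup>2 + b\<^sup>2) * rinner x x - 2 * a * rinner y x + rinner y y"
          by (simp only: rinner_simps)
        also have "\<dots> = b\<^sup>2 * rinner x x + rinner (y - a *\<^sub>R x) (y - a *\<^sub>R x)"
          unfolding rinner_simps rinner_commute[of x y] by (simp add: power2_eq_square algebra_simps)
        finally have "rinner (bop_apply (poly_op d X) x) x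
            = b\<^sup>2 * rinner x x + rinner (y - a *\<^sub>R x) (y - a *\<^sub>R x)" .
        then show ?thesis by (simp add: rinner_self)
      qed
      then show ?thesis using False by (intro bounded_below_if_coercive[of "b\<^sup>2"]) auto
    qed
    show ?thesis unfolding q poly_op_mult by (rule bounded_below_mult[OF bd bs])
  qed
qed

text \<open>The infimum \<open>a\<close> of the quadratic form of \<open>T\<close> is an approximate eigenvalue: the positive operator
  \<open>A = T - a\<close> satisfies \<open>\<parallel>Ax\<parallel>\<^sup>2 \<le> C \<langle>Ax, x\<rangle>\<close>, and the right side becomes arbitrarily small on
  unit vectors.\<close>

lemma nonneg_if_bounded_below:
  fixes T :: "'a::complex_hilbert bop"
  assumes T: "selfadjoint T" and bb: "\<And>a. a < 0 \<Longrightarrow> bounded_below (T - a *\<^sub>R 1)"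
  shows "0 \<le> T"
proof (rule ccontr)
  assume "\<not> 0 \<le> T"
  then obtain x0 where x0: "rinner (bop_apply T x0) x0 < 0"
    using T by (metis bop_nonneg_iff not_le)
  define Q where "Q = (\<lambda>x. rinner (bop_apply T x) x / (norm x)\<^sup>2) ` (UNIV - {0})"
  have x0n: "x0 \<noteq> 0" using x0 by (auto simp: rinner_zero)
  have "- norm T \<le> rinner (bop_apply T x) x / (norm x)\<^sup>2" if "x \<noteq> 0" for x
  proof -
    have "\<bar>rinner (bop_apply T x) x\<bar> \<le> norm T * norm x * norm x"
      using rinner_cauchy_schwarz[of "bop_apply T x" x] mult_right_mono[OF norm_bop_apply[of T x], of "norm x"]
      by simp
    then show ?thesis using that by (simp add: field_simps power2_eq_square abs_le_iff)
  qed
  then have bdd: "bdd_below Q" by (auto simp: Q_def intro!: bdd_belowI)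
  define a where "a = Inf Q"
  have aq: "a * (norm x)\<^sup>2 \<le> rinner (bop_apply T x) x" for x
  proof (cases "x = 0")
    case False
    then have "a \<le> rinner (bop_apply T x) x / (norm x)\<^sup>2"
      unfolding a_def using bdd by (intro cInf_lower) (auto simp: Q_def)
    then show ?thesis using False by (simp add: field_simps)
  qed (simp add: rinner_zero)
  have "a * (norm x0)\<^sup>2 < 0" using aq[of x0] x0 by simp
  then have "a < 0" by (simp add: mult_less_0_iff)
  define A where "A = T - a *\<^sub>R 1"
  have A: "selfadjoint A" "\<And>x. 0 \<le> rinner (bop_apply A x) x"
    using aq T by (auto simp: A_def selfadjoint_closed rinner_simps rinner_self)
  obtain c where c: "0 < c" "\<And>x. c * norm x \<le> norm (bop_apply A x)"
    using bb[OF \<open>a < 0\<close>] unfolding bounded_below_def A_def by blast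
  define s where "s = 1 / (norm A + 1)"
  have s: "0 < s" "s * norm A \<le> 1" by (simp_all add: s_def pos_divide_le_eq add_nonneg_pos)
  have key: "s * (norm (bop_apply A x))\<^sup>2 \<le> rinner (bop_apply A x) x" for x
  proof -
    define y where "y = bop_apply A x"
    \<comment> \<open>Expand the form of \<open>A\<close> at \<open>x - s A x\<close>.\<close>
    have "0 \<le> rinner (bop_apply A (x - s *\<^sub>R y)) (x - s *\<^sub>R y)" by (rule A(2))
    also have "\<dots> = rinner y x - 2 * s * (norm y)\<^sup>2 + s * (s * rinner (bop_apply A y) y)"
      using selfadjoint_rinner[OF A(1), of y x]
      by (simp add: bop_apply_linear rinner_simps y_def[symmetric] rinner_self algebra_simps)
    also have "s * (s * rinner (bop_apply A y) y) \<le> s * (norm y)\<^sup>2"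
    proof (rule mult_left_mono)
      have "rinner (bop_apply A y) y \<le> norm A * norm y * norm y"
        using rinner_cauchy_schwarz[of "bop_apply A y" y] mult_right_mono[OF norm_bop_apply[of A y], of "norm y"]
        by simp
      then have "s * rinner (bop_apply A y) y \<le> s * (norm A * norm y * norm y)"
        using s(1) by simp
      also have "\<dots> = s * norm A * (norm y)\<^sup>2" by (simp add: power2_eq_square)
      also have "\<dots> \<le> 1 * (norm y)\<^sup>2" using s(2) by (intro mult_right_mono) auto
      finally show "s * rinner (bop_apply A y) y \<le> (norm y)\<^sup>2" by simp
    qed (use s in simp)
    finally show ?thesis by (simp add: y_def)
  qed
  have "a + s * c\<^sup>2 \<le> rinner (bop_apply T x) x / (norm x)\<^sup>2" if "x \<noteq> 0" for x
  proof -
    have "s * (c * norm x)\<^sup>2 \<le> s * (norm (bop_apply A x))\<^sup>2"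
      using s(1) c power_mono[OF c(2)[of x], of 2] by simp
    also have "\<dots> \<le> rinner (bop_apply T x) x - a * (norm x)\<^sup>2"
      using key[of x] by (simp add: A_def rinner_simps rinner_self)
    finally show ?thesis using that by (simp add: field_simps power_mult_distrib)
  qed
  then have "a + s * c\<^sup>2 \<le> a"
    unfolding a_def using x0n by (intro cInf_greatest) (auto simp: Q_def)
  then show False using s(1) c(1) by (simp add: mult_le_0_iff)
qed

text \<open>On the zero space the spectrum is empty, and constant polynomials have to be treated separately:
  there the nonconstant case shows that \<open>X\<close> exceeds every multiple of the identity.\<close>

lemma poly_op_nonneg:
  fixes X :: "'a::complex_hilbert bop"
  assumes X: "selfadjoint X" and p: "\<And>t. complex_of_real t \<in> spectrum X \<Longrightarrow> 0 \<le> poly p t"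
  shows "0 \<le> poly_op p X"
proof -
  have const: "poly_op [:c:] X = c *\<^sub>R 1" for c by (simp add: poly_op_pCons)
  have main: "0 \<le> poly_op q X"
    if q: "\<And>t. complex_of_real t \<in> spectrum X \<Longrightarrow> 0 \<le> poly q t" and "\<And>a. a < 0 \<Longrightarrow> q \<noteq> [:a:]" for q
  proof (rule nonneg_if_bounded_below)
    fix a :: real assume a: "a < 0"
    have "bounded_below (poly_op (q - [:a:]) X)"
      using q a that(2)[OF a] by (intro poly_op_bounded_below[OF X]) fastforce+
    then show "bounded_below (poly_op q X - a *\<^sub>R 1)" by (simp add: poly_op_diff const)
  qed (rule selfadjoint_poly_op[OF X])
  show ?thesis
  proof (cases "\<exists>a<0. p = [:a:]")
    case True
    then have empty: "complex_of_real t \<notin> spectrum X" for t using p[of t] by auto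
    have "0 \<le> poly_op [:- (norm X + 1), 1:] X" using empty by (intro main) auto
    then have "(norm X + 1) * (norm x)\<^sup>2 \<le> rinner (bop_apply X x) x" for x
      by (simp add: bop_nonneg_iff poly_op_pCons rinner_simps rinner_self algebra_simps)
    moreover have "rinner (bop_apply X x) x \<le> norm X * (norm x)\<^sup>2" for x
      using rinner_cauchy_schwarz[of "bop_apply X x" x] mult_right_mono[OF norm_bop_apply[of X x], of "norm x"]
      by (simp add: power2_eq_square)
    ultimately have "(norm X + 1) * (norm x)\<^sup>2 \<le> norm X * (norm x)\<^sup>2" for x :: 'a
      by (meson order_trans)
    then have "x = 0" for x :: 'a by (simp add: algebra_simps)
    then have "rinner (bop_apply (poly_op p X) x) x = 0" for x by (metis rinner_zero(2))
    then show ?thesis using selfadjoint_poly_op[OF X] by (simp add: bop_nonneg_iff)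
  next
    case False
    then show ?thesis using p by (intro main) auto
  qed
qed

text \<open>The contraction property of the polynomial calculus: apply positivity to \<open>c - p\<close> and \<open>c + p\<close>.\<close>

lemma norm_poly_op_le:
  fixes X :: "'a::complex_hilbert bop"
  assumes "selfadjoint X" "0 \<le> c" "\<And>t. complex_of_real t \<in> spectrum X \<Longrightarrow> \<bar>poly p t\<bar> \<le> c"
  shows "norm (poly_op p X) \<le> c"
proof (rule norm_le_of_form_bounds)
  have const: "poly_op [:c:] X = c *\<^sub>R 1" by (simp add: poly_op_pCons)
  have "0 \<le> poly_op ([:c:] - p) X" "0 \<le> poly_op ([:c:] + p) X"
    using assms(3) by (intro poly_op_nonneg[OF assms(1)]; fastforce simp: abs_le_iff)+
  then show "0 \<le> c *\<^sub>R 1 - poly_op p X" "0 \<le> c *\<^sub>R 1 + poly_op p X"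
    by (simp_all only: poly_op_diff poly_op_add const)
qed (use assms selfadjoint_poly_op in auto)

section \<open>The continuous functional calculus\<close>

text \<open>Limit and uniqueness both come from \<open>\<parallel>p(X)\<parallel> \<le> sup \<bar>p\<bar>\<close> over the real spectrum of \<open>X\<close>: two
  sequences of polynomials that converge to \<open>f\<close> there give operators that approach each other.\<close>

lemma cfc_limit:
  fixes X :: "'a::complex_hilbert bop"
  assumes X: "selfadjoint X"
    and p: "uniform_limit {t. complex_of_real t \<in> spectrum X} (\<lambda>k. poly (p k)) f sequentially"
  shows "(\<lambda>k. poly_op (p k) X) \<longlonglongrightarrow> cfc f X"
proof -
  let ?\<sigma> = "{t. complex_of_real t \<in> spectrum X}"
  have close: "\<exists>N. \<forall>j\<ge>N. \<forall>k\<ge>N. norm (poly_op (q j) X - poly_op (r k) X) < e"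
    if qr: "uniform_limit ?\<sigma> (\<lambda>k. poly (q k)) f sequentially"
      "uniform_limit ?\<sigma> (\<lambda>k. poly (r k)) f sequentially" and e: "0 < e" for q r e
  proof -
    have "0 < e / 4" using e by simp
    then obtain N1 N2 where
      N1: "\<And>k t. N1 \<le> k \<Longrightarrow> t \<in> ?\<sigma> \<Longrightarrow> \<bar>poly (q k) t - f t\<bar> < e / 4" and
      N2: "\<And>k t. N2 \<le> k \<Longrightarrow> t \<in> ?\<sigma> \<Longrightarrow> \<bar>poly (r k) t - f t\<bar> < e / 4"
      using qr unfolding uniform_limit_sequentially_iff dist_real_def by metis
    have "norm (poly_op (q j) X - poly_op (r k) X) < e" if "max N1 N2 \<le> j" "max N1 N2 \<le> k" for j k
    proof -
      have "norm (poly_op (q j - r k) X) \<le> e / 2"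
      proof (rule norm_poly_op_le[OF X])
        fix t assume "complex_of_real t \<in> spectrum X"
        then show "\<bar>poly (q j - r k) t\<bar> \<le> e / 2"
          using N1[of j t] N2[of k t] that unfolding poly_diff mem_Collect_eq max.bounded_iff by linarith
      qed (use \<open>0 < e\<close> in simp)
      then show ?thesis using \<open>0 < e\<close> by (simp add: poly_op_diff)
    qed
    then show ?thesis by blast
  qed
  have "Cauchy (\<lambda>k. poly_op (p k) X)"
    unfolding Cauchy_def dist_norm using close[OF p p] by blast
  then obtain T where T: "(\<lambda>k. poly_op (p k) X) \<longlonglongrightarrow> T"
    using Cauchy_convergent convergent_def by blast
  have "cfc f X = T"
    unfolding cfc_def
  proof (rule the_equality)
    fix T' assume "\<exists>q. uniform_limit ?\<sigma> (\<lambda>k. poly (q k)) f sequentially \<and> (\<lambda>k. poly_op (q k) X) \<longlonglongrightarrow> T'"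
    then obtain q where q: "uniform_limit ?\<sigma> (\<lambda>k. poly (q k)) f sequentially"
      "(\<lambda>k. poly_op (q k) X) \<longlonglongrightarrow> T'" by blast
    have "(\<lambda>k. poly_op (q k) X - poly_op (p k) X) \<longlonglongrightarrow> 0"
      unfolding LIMSEQ_iff using close[OF q(1) p] by auto blast
    then have "T' - T = 0"
      using LIMSEQ_unique tendsto_diff[OF q(2) T] by blast
    then show "T' = T" by simp
  qed (use p T in blast)
  with T show ?thesis by simp
qed

lemma cfc_poly:
  assumes "selfadjoint X"
  shows "cfc (poly p) X = poly_op p X"
  using LIMSEQ_unique[OF cfc_limit[OF assms, of "\<lambda>_. p" "poly p"] tendsto_const]
  by (simp add: uniform_limit_const)

lemma weierstrass_poly:
  fixes f :: "real \<Rightarrow> real"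
  assumes "continuous_on {m..M} f"
  obtains p where "\<And>k t. t \<in> {m..M} \<Longrightarrow> \<bar>f t - poly (p k) t\<bar> < inverse (real (Suc k))"
proof -
  have "\<exists>p. \<forall>t\<in>{m..M}. \<bar>f t - poly p t\<bar> < inverse (real (Suc k))" for k
  proof -
    have "0 < inverse (real (Suc k))" by simp
    then obtain g where g: "real_polynomial_function g"
      "\<And>t. t \<in> {m..M} \<Longrightarrow> \<bar>f t - g t\<bar> < inverse (real (Suc k))"
      using Stone_Weierstrass_real_polynomial_function[OF compact_Icc assms] by metis
    then obtain a n where "g = (\<lambda>x. \<Sum>i\<le>n. a i * x ^ i)"
      using real_polynomial_function_iff_sum by blast
    then have "g = poly (\<Sum>i\<le>n. monom (a i) i)"
      by (simp add: poly_sum poly_monom fun_eq_iff)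
    then show ?thesis using g(2) by blast
  qed
  then show ?thesis using that by metis
qed

lemma uniform_limit_inverse_Suc:
  assumes "\<And>k t. t \<in> A \<Longrightarrow> \<bar>f t - poly (p k) t\<bar> < inverse (real (Suc k))"
  shows "uniform_limit A (\<lambda>k. poly (p k)) f sequentially"
  unfolding uniform_limit_iff
proof safe
  fix e :: real assume "0 < e"
  then have "\<forall>\<^sub>F k in sequentially. inverse (real (Suc k)) < e"
    using LIMSEQ_inverse_real_of_nat by (rule order_tendstoD(2)[rotated])
  then show "\<forall>\<^sub>F k in sequentially. \<forall>t\<in>A. dist (poly (p k) t) (f t) < e"
    by (rule eventually_mono)
      (auto simp: dist_real_def abs_minus_commute simp del: of_nat_Suc intro: less_trans[OF assms])
qed

text \<open>Approximating polynomials satisfy the inequality up to \<open>2/(k+1)\<close> on the spectrum, which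
  therefore holds for the operators too and disappears in the limit.\<close>

lemma cfc_mono:
  fixes X :: "'a::complex_hilbert bop"
  assumes X: "selfadjoint X" and spec: "\<And>t. complex_of_real t \<in> spectrum X \<Longrightarrow> t \<in> {m..M}"
    and f: "continuous_on {m..M} f" and g: "continuous_on {m..M} g"
    and le: "\<And>t. t \<in> {m..M} \<Longrightarrow> f t \<le> g t"
  shows "cfc f X \<le> cfc g X"
proof -
  obtain p where p: "\<And>k t. t \<in> {m..M} \<Longrightarrow> \<bar>f t - poly (p k) t\<bar> < inverse (real (Suc k))"
    using weierstrass_poly[OF f] by blast
  obtain q where q: "\<And>k t. t \<in> {m..M} \<Longrightarrow> \<bar>g t - poly (q k) t\<bar> < inverse (real (Suc k))"
    using weierstrass_poly[OF g] by blast
  have lim: "(\<lambda>k. poly_op (p k) X) \<longlonglongrightarrow> cfc f X" "(\<lambda>k. poly_op (q k) X) \<longlonglongrightarrow> cfc g X"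
    using spec p q by (auto intro!: cfc_limit[OF X] uniform_limit_inverse_Suc)
  define D where "D k = q k - p k + [:2 * inverse (real (Suc k)):]" for k
  have "0 \<le> poly_op (D k) X" for k
  proof (rule poly_op_nonneg[OF X])
    fix t assume "complex_of_real t \<in> spectrum X"
    then have "t \<in> {m..M}" by (rule spec)
    then show "0 \<le> poly (D k) t"
      using p[of t k] q[of t k] le[of t] by (simp add: D_def del: of_nat_Suc)
  qed
  moreover have "(\<lambda>k. poly_op (D k) X) \<longlonglongrightarrow> cfc g X - cfc f X + (2 * 0) *\<^sub>R 1 + X * 0"
    unfolding D_def poly_op_add poly_op_diff poly_op_pCons poly_op_0 add.assoc[symmetric]
    by (intro tendsto_intros lim LIMSEQ_inverse_real_of_nat)
  ultimately have "0 \<le> cfc g X - cfc f X"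
    using bop_nonneg_limit by fastforce
  then show ?thesis by (simp add: bop_le_iff_diff[of "cfc f X"])
qed

section \<open>The scalar inequalities\<close>

text \<open>The function whose functional calculus stands in the middle of the operator inequality.\<close>

definition interpolant :: "(real \<Rightarrow> real) \<Rightarrow> real \<Rightarrow> real \<Rightarrow> real \<Rightarrow> real" where
  "interpolant f m M t = Kconst f m M powr tilde m M t
     * f m powr ((M - t) / (M - m)) * f M powr ((t - m) / (M - m))"

lemma log_convex_on_pos:
  assumes "m < M" "log_convex_on {m..M} f"
  shows "0 < f m" "0 < f M" "0 < f ((m + M) / 2)"
  using assms by (auto simp: log_convex_on_def)

lemma Kconst_pos:
  assumes "m < M" "log_convex_on {m..M} f"
  shows "0 < Kconst f m M"
  using log_convex_on_pos[OF assms] by (simp add: Kconst_def)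

lemma ln_interpolant:
  assumes mM: "m < M" and f: "log_convex_on {m..M} f"
  shows "0 < interpolant f m M t"
    "ln (interpolant f m M t)
      = tilde m M t * (2 * ln (f ((m + M) / 2)) - ln (f m) - ln (f M))
        + (M - t) / (M - m) * ln (f m) + (t - m) / (M - m) * ln (f M)"
proof -
  note pos = log_convex_on_pos[OF assms] Kconst_pos[OF assms]
  show "0 < interpolant f m M t"
    using pos by (simp add: interpolant_def)
  have "ln (Kconst f m M) = 2 * ln (f ((m + M) / 2)) - ln (f m) - ln (f M)"
    using pos by (simp add: Kconst_def ln_div ln_mult ln_realpow)
  then show "ln (interpolant f m M t)
      = tilde m M t * (2 * ln (f ((m + M) / 2)) - ln (f m) - ln (f M))
        + (M - t) / (M - m) * ln (f m) + (t - m) / (M - m) * ln (f M)"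
    using pos by (simp add: interpolant_def ln_mult ln_powr)
qed

text \<open>The logarithm of the interpolant is the piecewise linear interpolation of \<open>ln f\<close> at \<open>m\<close>, the
  midpoint and \<open>M\<close>, which lies above the convex function \<open>ln f\<close> on both halves.\<close>

lemma log_convex_le_interpolant:
  assumes mM: "m < M" and f: "log_convex_on {m..M} f" and t: "t \<in> {m..M}"
  shows "f t \<le> interpolant f m M t"
proof -
  define v where "v = (t - m) / (M - m)"
  define c where "c = (m + M) / 2"
  have v: "0 \<le> v" "v \<le> 1" "t = m + v * (M - m)"
    using mM t by (simp_all add: v_def)
  have v': "(M - t) / (M - m) = 1 - v" using mM by (simp add: v_def field_simps)
  have conv: "convex_on {m..M} (\<lambda>x. ln (f x))" using f by (simp add: log_convex_on_def)
  have tc: "t - c = (v - 1 / 2) * (M - m)" by (simp add: v(3) c_def field_simps)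
  have tilde: "tilde m M t = 1 / 2 - \<bar>v - 1 / 2\<bar>"
    using mM tc by (simp add: tilde_def c_def[symmetric] abs_mult)
  note lnI = ln_interpolant(2)[OF mM f, of t, unfolded v' tilde, folded c_def v_def]
  have "ln (f t) \<le> ln (interpolant f m M t)"
  proof (cases "v \<le> 1 / 2")
    case True
    have "t = (1 - 2 * v) *\<^sub>R m + (2 * v) *\<^sub>R c" by (simp add: v(3) c_def algebra_simps)
    then have "ln (f t) \<le> (1 - 2 * v) * ln (f m) + 2 * v * ln (f c)"
      using convex_onD[OF conv, of "2 * v" m c] v True mM by (simp add: c_def)
    also have "\<dots> = ln (interpolant f m M t)"
      using True by (simp add: lnI algebra_simps)
    finally show ?thesis .
  next
    case False
    have "t = (1 - (2 * v - 1)) *\<^sub>R c + (2 * v - 1) *\<^sub>R M" by (simp add: v(3) c_def field_simps)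
    then have "ln (f t) \<le> (1 - (2 * v - 1)) * ln (f c) + (2 * v - 1) * ln (f M)"
      using convex_onD[OF conv, of "2 * v - 1" c M] v False mM by (simp add: c_def)
    also have "\<dots> = ln (interpolant f m M t)"
      using False by (simp add: lnI algebra_simps)
    finally show ?thesis .
  qed
  moreover have "0 < f t" using f t by (simp add: log_convex_on_def)
  ultimately show ?thesis using ln_interpolant(1)[OF mM f, of t] by simp
qed

text \<open>Midpoint convexity of \<open>ln f\<close> gives \<open>K \<le> 1\<close>, and the remaining weighted geometric mean of
  \<open>f m\<close> and \<open>f M\<close> is at most the arithmetic one.\<close>

lemma interpolant_le_chord:
  assumes mM: "m < M" and f: "log_convex_on {m..M} f" and t: "t \<in> {m..M}"
  shows "interpolant f m M t \<le> (M - t) / (M - m) * f m + (t - m) / (M - m) * f M"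
proof -
  note pos = log_convex_on_pos[OF mM f] Kconst_pos[OF mM f]
  have conv: "convex_on {m..M} (\<lambda>x. ln (f x))" using f by (simp add: log_convex_on_def)
  have mid: "(1 - 1 / 2) *\<^sub>R m + (1 / 2) *\<^sub>R M = (m + M) / 2" by (simp add: field_simps)
  have "ln (f ((m + M) / 2)) \<le> (1 - 1 / 2) * ln (f m) + 1 / 2 * ln (f M)"
    using convex_onD[OF conv, of "1 / 2" m M] mM unfolding mid by simp
  then have "ln (Kconst f m M) \<le> 0"
    using pos by (simp add: Kconst_def ln_div ln_mult ln_realpow)
  then have K: "Kconst f m M \<le> 1" using pos by simp
  have "\<bar>t - (m + M) / 2\<bar> \<le> (M - m) / 2" using t by (auto simp: abs_le_iff field_simps)
  then have "0 \<le> tilde m M t" using mM by (simp add: tilde_def field_simps)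
  then have "Kconst f m M powr tilde m M t \<le> 1" using K pos by (simp add: powr_le1)
  then have "interpolant f m M t \<le> f m powr ((M - t) / (M - m)) * f M powr ((t - m) / (M - m))"
    using pos by (simp add: interpolant_def mult.assoc mult_left_le_one_le)
  also have "\<dots> \<le> (M - t) / (M - m) * f m + (t - m) / (M - m) * f M"
    using t mM pos by (intro Youngs_inequality_0) (auto simp: add_divide_distrib[symmetric])
  finally show ?thesis .
qed

lemma continuous_on_interpolant:
  assumes "m < M" "log_convex_on {m..M} f"
  shows "continuous_on A (interpolant f m M)"
proof -
  note pos = log_convex_on_pos[OF assms] Kconst_pos[OF assms]
  show ?thesis
    unfolding interpolant_def tilde_def using pos assms(1) by (intro continuous_intros) auto
qed

section \<open>The operator inequality\<close>

lemma positive_map_diff: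
  assumes "positive_map \<Phi>"
  shows "\<Phi> (X - Y) = \<Phi> X - \<Phi> Y"
proof -
  have "\<Phi> (X - Y) + \<Phi> Y = \<Phi> X"
    using assms unfolding positive_map_def clinear_map_def by (metis diff_add_cancel)
  then show ?thesis by (metis add_diff_cancel_right')
qed

lemma positive_map_affine:
  assumes "positive_map \<Phi>"
  shows "\<Phi> (a *\<^sub>R X + b *\<^sub>R Y) = a *\<^sub>R \<Phi> X + b *\<^sub>R \<Phi> Y"
  using assms by (simp add: positive_map_def clinear_map_def scaleR_scaleC)

lemma positive_map_mono:
  assumes "positive_map \<Phi>" "X \<le> Y"
  shows "\<Phi> X \<le> \<Phi> Y"
  using assms(2) positive_map_diff[OF assms(1), of Y X] assms(1)
  unfolding bop_le_iff_diff[of X] bop_le_iff_diff[of "\<Phi> X"] positive_map_def by metis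

text \<open>For polynomials of degree one, positivity on the spectrum turns spectral bounds into order
  bounds; \<open>real_spectrum_bounds\<close> is the converse. Only the order bounds survive under positive
  maps, so both directions are needed to locate the spectrum of \<open>M + m - S\<close>.\<close>

lemma spectral_bounds:
  assumes "selfadjoint X" "\<And>t. complex_of_real t \<in> spectrum X \<Longrightarrow> t \<in> {m..M}"
  shows "m *\<^sub>R 1 \<le> X" "X \<le> M *\<^sub>R 1"
proof -
  have "0 \<le> poly_op [:- m, 1:] X" "0 \<le> poly_op [:M, - 1:] X"
    using assms by (auto intro!: poly_op_nonneg)
  then show "m *\<^sub>R 1 \<le> X" "X \<le> M *\<^sub>R 1"
    by (simp_all add: poly_op_pCons bop_le_iff_diff[of _ X] bop_le_iff_diff[of X])
qed

theorem mainTheorem4: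
  fixes m M :: real and f :: "real \<Rightarrow> real" and n :: nat
    and B :: "nat \<Rightarrow> 'a::complex_hilbert bop"
    and \<Phi> :: "nat \<Rightarrow> 'a bop \<Rightarrow> 'a bop"
    and K :: real and S :: "'a bop"
  assumes "m < M"
    and "continuous_on {m..M} f"
    and "log_convex_on {m..M} f"
    and "\<And>i. i \<in> {1..n} \<Longrightarrow> selfadjoint (B i)"
    and "\<And>i. i \<in> {1..n} \<Longrightarrow> spectrum (B i) \<subseteq> complex_of_real ` {m..M}"
    and "\<And>i. i \<in> {1..n} \<Longrightarrow> positive_map (\<Phi> i)"
    and "(\<Sum>i=1..n. \<Phi> i 1) = 1"
    and "K = Kconst f m M"
    and "S = (\<Sum>i=1..n. \<Phi> i (B i))"
  shows "let R = (\<Sum>i=1..n. \<Phi> i (cfc (\<lambda>t. K powr tilde m M t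
              * f m powr ((M - t) / (M - m)) * f M powr ((t - m) / (M - m))) (B i)))
          + cfc (\<lambda>t. let s = M + m - t in K powr tilde m M t
              * f m powr ((s - m) / (M - m)) * f M powr ((M - s) / (M - m)))
            ((M + m) *\<^sub>R 1 - S)
    in (\<Sum>i=1..n. \<Phi> i (cfc f (B i))) + cfc f ((M + m) *\<^sub>R 1 - S) \<le> R
      \<and> R \<le> (f m + f M) *\<^sub>R 1"
proof -
  define C where "C = (M + m) *\<^sub>R 1 - S"
  define g where "g = interpolant f m M"
  \<comment> \<open>\<open>c0 + c1 t\<close> is the chord of \<open>f\<close> from \<open>m\<close> to \<open>M\<close>.\<close>
  define c1 where "c1 = (f M - f m) / (M - m)"
  define c0 where "c0 = (M * f m - m * f M) / (M - m)"
  have g1: "(\<lambda>t. K powr tilde m M t * f m powr ((M - t) / (M - m)) * f M powr ((t - m) / (M - m))) = g"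
    by (simp add: g_def interpolant_def fun_eq_iff assms(8))
  \<comment> \<open>At \<open>M + m - S\<close> the exponents are those of the same function \<open>g\<close>, as \<open>s - m = M - t\<close>.\<close>
  have g2: "(\<lambda>t. let s = M + m - t in K powr tilde m M t
      * f m powr ((s - m) / (M - m)) * f M powr ((M - s) / (M - m))) = g"
    by (simp add: g_def interpolant_def fun_eq_iff assms(8))
  have chord: "poly [:c0, c1:] t = (M - t) / (M - m) * f m + (t - m) / (M - m) * f M" for t
    using assms(1) by (simp add: c0_def c1_def field_simps)
  have pos: "positive_map (\<Phi> i)" if "i \<in> {1..n}" for i using assms(6) that .
  have spec: "t \<in> {m..M}" if "i \<in> {1..n}" "complex_of_real t \<in> spectrum (B i)" for i t
    using assms(5)[OF that(1)] that(2) by auto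
  note bounds = spectral_bounds[OF assms(4) spec]
  have affine: "(\<Sum>i=1..n. \<Phi> i (a *\<^sub>R 1 + b *\<^sub>R B i)) = a *\<^sub>R 1 + b *\<^sub>R S" for a b
  proof -
    have "(\<Sum>i=1..n. \<Phi> i (a *\<^sub>R 1 + b *\<^sub>R B i)) = (\<Sum>i=1..n. a *\<^sub>R \<Phi> i 1 + b *\<^sub>R \<Phi> i (B i))"
      by (intro sum.cong refl positive_map_affine pos)
    then show ?thesis
      unfolding assms(9) sum.distrib scaleR_sum_right[symmetric] assms(7) .
  qed
  have "m *\<^sub>R 1 \<le> S"
    using bop_sum_mono[of "{1..n}" "\<lambda>i. \<Phi> i (m *\<^sub>R 1 + 0 *\<^sub>R B i)" "\<lambda>i. \<Phi> i (0 *\<^sub>R 1 + 1 *\<^sub>R B i)"]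
      bounds(1) pos unfolding affine by (simp add: positive_map_mono)
  moreover have "S \<le> M *\<^sub>R 1"
    using bop_sum_mono[of "{1..n}" "\<lambda>i. \<Phi> i (0 *\<^sub>R 1 + 1 *\<^sub>R B i)" "\<lambda>i. \<Phi> i (M *\<^sub>R 1 + 0 *\<^sub>R B i)"]
      bounds(2) pos unfolding affine by (simp add: positive_map_mono)
  ultimately have C: "m *\<^sub>R 1 \<le> C" "C \<le> M *\<^sub>R 1"
    by (simp_all add: C_def bop_le_iff_diff[of "m *\<^sub>R 1"] bop_le_iff_diff[of _ "M *\<^sub>R 1"] algebra_simps)
  have "selfadjoint (C - m *\<^sub>R 1)"
    using C(1) by (simp add: bop_le_iff_diff[of _ C] bop_nonneg_iff)
  then have "selfadjoint (C - m *\<^sub>R 1 + m *\<^sub>R 1)"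
    by (rule selfadjoint_closed(3)[OF _ selfadjoint_closed(5)[OF selfadjoint_closed(2)]])
  then have Csa: "selfadjoint C" unfolding diff_add_cancel .
  have step: "cfc f X \<le> cfc g X" "cfc g X \<le> c0 *\<^sub>R 1 + c1 *\<^sub>R X"
    if X: "selfadjoint X" and sp: "\<And>t. complex_of_real t \<in> spectrum X \<Longrightarrow> t \<in> {m..M}" for X :: "'a bop"
  proof -
    note cont = continuous_on_interpolant[OF assms(1,3), of "{m..M}"]
    show "cfc f X \<le> cfc g X"
      unfolding g_def using log_convex_le_interpolant[OF assms(1,3)]
      by (intro cfc_mono[OF X sp assms(2) cont]) auto
    have "cfc g X \<le> cfc (poly [:c0, c1:]) X"
      unfolding g_def using interpolant_le_chord[OF assms(1,3)]
      by (intro cfc_mono[OF X sp cont]) (auto simp only: chord intro!: continuous_intros)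
    then show "cfc g X \<le> c0 *\<^sub>R 1 + c1 *\<^sub>R X"
      by (simp only: cfc_poly[OF X]) (simp add: poly_op_pCons)
  qed
  have stepB: "\<Phi> i (cfc f (B i)) \<le> \<Phi> i (cfc g (B i))"
    "\<Phi> i (cfc g (B i)) \<le> \<Phi> i (c0 *\<^sub>R 1 + c1 *\<^sub>R B i)" if i: "i \<in> {1..n}" for i
    using step[OF assms(4)[OF i] spec[OF i]] positive_map_mono[OF pos[OF i]] by blast+
  have stepC: "cfc f C \<le> cfc g C" "cfc g C \<le> c0 *\<^sub>R 1 + c1 *\<^sub>R C"
    using step[OF Csa real_spectrum_bounds[OF C]] by blast+
  define R where "R = (\<Sum>i=1..n. \<Phi> i (cfc g (B i))) + cfc g C"
  have "(\<Sum>i=1..n. \<Phi> i (cfc f (B i))) + cfc f C \<le> R"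
    unfolding R_def by (rule bop_add_mono[OF bop_sum_mono[OF stepB(1)] stepC(1)])
  moreover have "R \<le> (\<Sum>i=1..n. \<Phi> i (c0 *\<^sub>R 1 + c1 *\<^sub>R B i)) + (c0 *\<^sub>R 1 + c1 *\<^sub>R C)"
    unfolding R_def by (rule bop_add_mono[OF bop_sum_mono[OF stepB(2)] stepC(2)])
  moreover have "\<dots> = (f m + f M) *\<^sub>R 1"
  proof -
    have "poly [:c0, c1:] m + poly [:c0, c1:] M = f m + f M"
      unfolding chord using assms(1) by simp
    then have "f m + f M = c0 + c0 + c1 * (M + m)" by (simp add: algebra_simps)
    then have "(f m + f M) *\<^sub>R (1::'a bop) = c0 *\<^sub>R 1 + c0 *\<^sub>R 1 + c1 *\<^sub>R (M + m) *\<^sub>R 1"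
      by (simp only: scaleR_add_left[of "c0 + c0"] scaleR_add_left[of c0] scaleR_scaleR)
    then show ?thesis
      unfolding affine C_def by (simp add: scaleR_right_diff_distrib)
  qed
  ultimately show ?thesis
    unfolding g1 g2 C_def[symmetric] unfolding Let_def R_def by simp
qed

end
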